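(* Let $\mathcal{H}$ be an infinite-dimensional separable Hilbert space and let $H:\mathcal{H}\to\mathcal{H}$ be a bounded linear operator. Then the following are equivalent: (a) $H$ is a Hilbert–Schmidt operator; (b) $\sum_k \|Hf_k\|^2<\infty$ for some frame $(f_k)$ of $\mathcal{H}$; (c) $\sum_k \|Hf_k\|^2<\infty$ for every frame $(f_k)$ of $\mathcal{H}$. Moreover, if $H$ is Hilbert–Schmidt and $(f_k)$ is a frame for $\mathcal{H}$ with lower frame bound $A$ and upper frame bound $B$, then $$\sqrt{A}\,\|H\|_{\mathcal{HS}}\le\sqrt{\sum_k\|Hf_k\|^2}\le\sqrt{B}\,\|H\|_{\mathcal{HS}}.$$ In particular, if $(f_k)$ is a tight frame (i.e. one may take $A=B$), then $$\|H\|_{\mathcal{HS}}=\frac{1}{\sqrt{A}}\sqrt{\sum_k\|Hf_k\|^2}.$$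
   Context: A sequence $(f_k)_{k\in K}$ ($K$ a countable index set) in a separable Hilbert space $\mathcal{H}$ is a frame if there are constants $A,B>0$ (a lower and an upper frame bound) with $A\|f\|^2\le\sum_k|\langle f,f_k\rangle|^2\le B\|f\|^2$ for all $f\in\mathcal{H}$. A bounded operator $T$ is Hilbert–Schmidt if $\|T\|_{\mathcal{HS}}:=\left(\sum_n\|Te_n\|^2\right)^{1/2}<\infty$ for some orthonormal basis $(e_n)$ of its domain; the value is independent of the choice of orthonormal basis. *)

theory Defs
  imports "HOL-Analysis.Analysis" "HOL-Library.Infinite_Typeclass"
begin

text \<open>
  The scalar field of a Hilbert space is the real or the complex numbers. Both are covered by one
  class. It has no other models up to isomorphism: \<open>x + sconj x\<close> is real (expand
  \<open>(1 + x) * sconj (1 + x)\<close>), so every \<open>x\<close> is a root of the real quadratic polynomial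
  \<open>X\<^sup>2 - (x + sconj x) X + (norm x)\<^sup>2\<close>.
\<close>

class real_or_complex = real_normed_field +
  fixes sconj :: "'a \<Rightarrow> 'a"
  assumes sconj_add: "sconj (x + y) = sconj x + sconj y"
    and sconj_mult: "sconj (x * y) = sconj x * sconj y"
    and sconj_scaleR_1: "sconj (r *\<^sub>R 1) = r *\<^sub>R 1"
    and mult_sconj: "x * sconj x = (norm x)\<^sup>2 *\<^sub>R 1"

instantiation real :: real_or_complex
begin
definition sconj_real :: "real \<Rightarrow> real" where "sconj_real x = x"
instance by standard (auto simp: sconj_real_def power2_eq_square)
end

instantiation complex :: real_or_complex
begin
definition sconj_complex :: "complex \<Rightarrow> complex" where "sconj_complex = cnj"
instance
proof
  fix x :: complex
  show "x * sconj x = (norm x)\<^sup>2 *\<^sub>R 1"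
    by (simp only: sconj_complex_def complex_norm_square[symmetric] scaleR_conv_of_real mult_1_right)
qed (simp_all add: sconj_complex_def scaleR_conv_of_real)
end

text \<open>
  Norm, topology and completeness are those of the type class \<^class>\<open>banach\<close>. Scalar
  multiplication and inner product (linear in the first argument) are parameters, since the scalar
  field is not determined by the type of the vectors. Positive definiteness of \<open>ip\<close> is contained
  in \<open>ip_self\<close>.
\<close>

locale hilbert_space = vector_space smul
  for smul :: "'k::real_or_complex \<Rightarrow> 'a::banach \<Rightarrow> 'a" +
  fixes ip :: "'a \<Rightarrow> 'a \<Rightarrow> 'k"
  assumes smul_of_real: "smul (of_real r) x = r *\<^sub>R x"
    and ip_add_left: "ip (x + y) z = ip x z + ip y z"
    and ip_smul_left: "ip (smul c x) y = c * ip x y"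
    and ip_commute: "ip y x = sconj (ip x y)"
    and ip_self: "ip x x = of_real ((norm x)\<^sup>2)"

lemma hilbert_space_real:
  "hilbert_space scaleR (inner :: 'a::{real_inner,banach} \<Rightarrow> 'a \<Rightarrow> real)"
proof unfold_locales
  fix x y :: 'a
  show "inner y x = sconj (inner x y)"
    by (simp only: sconj_real_def inner_commute)
qed (simp_all add: scaleR_add_right scaleR_add_left inner_add_left power2_norm_eq_inner)

lemma hilbert_space_complex: "hilbert_space (*) (\<lambda>x y :: complex. x * cnj y)"
proof unfold_locales
  fix x y :: complex
  show "y * cnj x = sconj (x * cnj y)"
    by (simp add: sconj_complex_def mult.commute)
  show "x * cnj x = of_real ((norm x)\<^sup>2)"
    by (rule complex_norm_square[symmetric])
qed (simp_all add: distrib_left distrib_right mult.assoc scaleR_conv_of_real)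

definition infinite_dimensional :: "('k::field \<Rightarrow> 'a::ab_group_add \<Rightarrow> 'a) \<Rightarrow> bool" where
  "infinite_dimensional smul \<longleftrightarrow> \<not> (\<exists>B. finite B \<and> module.span smul B = UNIV)"

definition bounded_operator ::
    "('k::real_or_complex \<Rightarrow> 'a::banach \<Rightarrow> 'a) \<Rightarrow> ('a \<Rightarrow> 'a) \<Rightarrow> bool" where
  "bounded_operator smul T \<longleftrightarrow>
     Vector_Spaces.linear smul smul T \<and> (\<exists>C. \<forall>x. norm (T x) \<le> C * norm x)"

definition orthonormal_basis ::
    "('k::real_or_complex \<Rightarrow> 'a::banach \<Rightarrow> 'a) \<Rightarrow> ('a \<Rightarrow> 'a \<Rightarrow> 'k) \<Rightarrow> 'a set \<Rightarrow> bool" where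
  "orthonormal_basis smul ip E \<longleftrightarrow>
     (\<forall>x\<in>E. \<forall>y\<in>E. ip x y = (if x = y then 1 else 0)) \<and>
     closure (module.span smul E) = UNIV"

definition hilbert_schmidt ::
    "('k::real_or_complex \<Rightarrow> 'a::banach \<Rightarrow> 'a) \<Rightarrow> ('a \<Rightarrow> 'a \<Rightarrow> 'k) \<Rightarrow> ('a \<Rightarrow> 'a) \<Rightarrow> bool" where
  "hilbert_schmidt smul ip T \<longleftrightarrow> bounded_operator smul T \<and>
     (\<exists>E. orthonormal_basis smul ip E \<and> (\<lambda>e. (norm (T e))\<^sup>2) summable_on E)"

text \<open>The value does not depend on the orthonormal basis that is chosen.\<close>

definition hs_norm ::
    "('k::real_or_complex \<Rightarrow> 'a::banach \<Rightarrow> 'a) \<Rightarrow> ('a \<Rightarrow> 'a \<Rightarrow> 'k) \<Rightarrow> ('a \<Rightarrow> 'a) \<Rightarrow> real" where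
  "hs_norm smul ip T =
     sqrt (\<Sum>\<^sub>\<infinity>e\<in>(SOME E. orthonormal_basis smul ip E). (norm (T e))\<^sup>2)"

text \<open>
  Summability is required explicitly, because \<^const>\<open>infsum\<close> is 0 for families that are not
  summable.
\<close>

definition frame_with_bounds ::
    "('a::banach \<Rightarrow> 'a \<Rightarrow> 'k::real_or_complex) \<Rightarrow> 'i set \<Rightarrow> ('i \<Rightarrow> 'a) \<Rightarrow> real \<Rightarrow> real \<Rightarrow> bool" where
  "frame_with_bounds ip K f A B \<longleftrightarrow> countable K \<and> A > 0 \<and> B > 0 \<and>
     (\<forall>x. (\<lambda>k. (norm (ip x (f k)))\<^sup>2) summable_on K \<and>
          A * (norm x)\<^sup>2 \<le> (\<Sum>\<^sub>\<infinity>k\<in>K. (norm (ip x (f k)))\<^sup>2) \<and>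
          (\<Sum>\<^sub>\<infinity>k\<in>K. (norm (ip x (f k)))\<^sup>2) \<le> B * (norm x)\<^sup>2)"

text \<open>
  A formula cannot quantify over types. Where frames are quantified, their countable index sets
  are therefore taken inside an arbitrary infinite type \<open>'i\<close>; already for \<open>'i = nat\<close> these are all
  countable sets up to renaming of the indices.
\<close>

definition is_frame ::
    "('a::banach \<Rightarrow> 'a \<Rightarrow> 'k::real_or_complex) \<Rightarrow> 'i set \<Rightarrow> ('i \<Rightarrow> 'a) \<Rightarrow> bool" where
  "is_frame ip K f \<longleftrightarrow> (\<exists>A B. frame_with_bounds ip K f A B)"

end

(*
  With G the adjoint of H and (e) an orthonormal basis, Parseval gives
  sum_k |H f_k|^2 = sum_k sum_e |<H f_k, e>|^2 = sum_e sum_k |<G e, f_k>|^2,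
  and the inner sum on the right lies between A |G e|^2 and B |G e|^2. For f_k an orthonormal
  basis this is |H|_HS = |G|_HS, whatever the bases. Existence of a basis (Zorn) and of the
  adjoint (a bounded functional phi is represented by the sum of the conj(phi e) e) both rest on
  the Riesz-Fischer theorem.
*)

theory Submission
  imports Defs
begin

section \<open>Interchange of nonnegative double sums\<close>

text \<open>Tonelli for unordered sums: nonnegativity turns convergence of one iterated sum into
  summability over the product, where the two variables may be exchanged.\<close>

lemma has_sum_nonneg_swap:
  fixes g :: "'a \<Rightarrow> 'b \<Rightarrow> real"
  assumes nonneg: "\<And>x y. x \<in> X \<Longrightarrow> y \<in> Y \<Longrightarrow> g x y \<ge> 0"
    and rows: "\<And>x. x \<in> X \<Longrightarrow> (g x has_sum r x) Y"
    and cols: "\<And>y. y \<in> Y \<Longrightarrow> ((\<lambda>x. g x y) has_sum c y) X"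
    and total: "(r has_sum S) X"
  shows "(c has_sum S) Y"
proof -
  have "(\<lambda>(x, y). g x y) summable_on X \<times> Y"
    by (rule summable_on_SigmaI[where g = r])
      (use nonneg rows total in \<open>auto simp: summable_on_def\<close>)
  then have "((\<lambda>(x, y). g x y) has_sum S) (X \<times> Y)"
    by (intro has_sum_SigmaI[where g = r]) (use rows total in auto)
  then have "((\<lambda>(y, x). g x y) has_sum S) (Y \<times> X)"
    using has_sum_swap[of "\<lambda>(x, y). g x y" X Y S] by simp
  then show ?thesis
    by (rule has_sum_SigmaD) (use cols in auto)
qed

section \<open>Conjugation in the scalar field\<close>

lemma sconj_zero [simp]: "sconj (0 :: 'k::real_or_complex) = 0"
  using sconj_add[of "0 :: 'k" 0] by simp

lemma mult_sconj_of_real: "x * sconj x = of_real ((norm (x :: 'k::real_or_complex))\<^sup>2)"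
  by (simp add: mult_sconj of_real_def)

text \<open>Take norms in \<open>mult_sconj_of_real\<close>, use that the norm is multiplicative,
  and cancel \<open>norm x\<close>.\<close>

lemma norm_sconj [simp]: "norm (sconj x) = norm (x :: 'k::real_or_complex)"
proof (cases "x = 0")
  case False
  have "norm x * norm (sconj x) = norm x * norm x"
    unfolding norm_mult[symmetric] mult_sconj_of_real by (simp add: power2_eq_square norm_mult)
  with False show ?thesis by simp
qed simp

text \<open>Being an involution is not an axiom of the class. Since \<open>x\<close> and
  \<open>sconj x\<close> have equal norms, the products of each with its conjugate agree, and
  \<open>sconj x\<close> cancels.\<close>

lemma sconj_sconj [simp]: "sconj (sconj x) = (x :: 'k::real_or_complex)"
proof (cases "x = 0")
  case False
  have "sconj x * sconj (sconj x) = sconj x * x"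
    using mult_sconj_of_real[of x] mult_sconj_of_real[of "sconj x"] by (simp add: mult.commute)
  moreover have "sconj x \<noteq> 0"
    using False norm_sconj[of x] by (metis norm_eq_zero)
  ultimately show ?thesis by simp
qed simp

section \<open>Elementary geometry of the inner product\<close>

context hilbert_space
begin

lemma ip_zero_left [simp]: "ip 0 y = 0"
  using ip_add_left[of 0 0 y] by simp

lemma ip_zero_right [simp]: "ip x 0 = 0"
  using ip_commute[of x 0] by simp

lemma ip_add_right: "ip x (y + z) = ip x y + ip x z"
  using ip_commute[of "y + z" x] by (metis ip_add_left ip_commute sconj_add)

lemma ip_smul_right: "ip x (smul c y) = sconj c * ip x y"
  by (metis ip_smul_left ip_commute sconj_mult)

lemma ip_diff_left: "ip (x - y) z = ip x z - ip y z"
  using ip_add_left[of "x - y" y z] by (simp add: algebra_simps)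

lemma ip_sum_left: "ip (\<Sum>i\<in>I. u i) y = (\<Sum>i\<in>I. ip (u i) y)"
  by (induction I rule: infinite_finite_induct) (auto simp: ip_add_left)

lemma norm_ip_commute: "norm (ip y x) = norm (ip x y)"
  by (metis ip_commute norm_sconj)

lemma ip_eq_zero_commute: "ip y x = 0 \<longleftrightarrow> ip x y = 0"
  by (metis norm_ip_commute norm_eq_zero)

text \<open>The class \<open>banach\<close> relates the norm to real scalars only. For scalars in
  \<open>'k\<close> the relation comes from \<open>ip_self\<close>: squared norms are compared
  inside \<open>'k\<close> through the injective \<open>of_real\<close>.\<close>

lemma norm_smul: "norm (smul c x) = norm c * norm x"
proof -
  have "(of_real ((norm (smul c x))\<^sup>2) :: 'k) = of_real ((norm c * norm x)\<^sup>2)"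
    by (simp only: ip_self[symmetric] ip_smul_left ip_smul_right mult.assoc[symmetric]
        mult.commute[of "sconj c"] mult_sconj_of_real power_mult_distrib of_real_mult)
  then show ?thesis
    by (simp only: of_real_eq_iff) (simp add: power2_eq_iff_nonneg)
qed

lemma pythagoras:
  assumes "ip x y = 0"
  shows "(norm (x + y))\<^sup>2 = (norm x)\<^sup>2 + (norm y)\<^sup>2"
proof -
  have "(of_real ((norm (x + y))\<^sup>2) :: 'k) = of_real ((norm x)\<^sup>2 + (norm y)\<^sup>2)"
    using assms ip_eq_zero_commute[of x y]
    by (simp only: ip_self[symmetric] ip_add_left ip_add_right of_real_add) simp
  then show ?thesis
    by (simp only: of_real_eq_iff)
qed

text \<open>With \<open>smul c y\<close> the projection of \<open>x\<close> onto the line of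
  \<open>y\<close>, the remainder is orthogonal to it, so Pythagoras bounds the length of the
  projection by that of \<open>x\<close>.\<close>

lemma cauchy_schwarz: "norm (ip x y) \<le> norm x * norm y"
proof (cases "y = 0")
  case False
  define c where "c = ip x y / ip y y"
  have "ip (x - smul c y) (smul c y) = 0"
    using False by (simp add: c_def ip_smul_right ip_diff_left ip_smul_left ip_self)
  from pythagoras[OF this] have "(norm (smul c y))\<^sup>2 \<le> (norm x)\<^sup>2"
    by simp
  then have "norm c * norm y \<le> norm x"
    unfolding norm_smul by (rule power2_le_imp_le) simp
  moreover have "norm c = norm (ip x y) / (norm y)\<^sup>2"
    by (simp add: c_def ip_self norm_divide norm_power)
  ultimately show ?thesis
    using False by (simp add: field_simps power2_eq_square)
qed simp

text \<open>Here \<open>bounded_linear\<close> means linear over the reals, whatever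
  \<open>'k\<close> is. This is what carries the inner product through infinite sums and
  limits.\<close>

lemma bounded_linear_ip_left: "bounded_linear (\<lambda>x. ip x y)"
proof (rule bounded_linear_intro[where K = "norm y"])
  show "ip (r *\<^sub>R x) y = r *\<^sub>R ip x y" for r x
    unfolding smul_of_real[symmetric] ip_smul_left by (simp add: scaleR_conv_of_real)
qed (auto simp: ip_add_left cauchy_schwarz)

section \<open>Orthonormal sets: Bessel and Riesz-Fischer\<close>

text \<open>Orthonormality separated from density, so that Zorn's lemma can be applied to
  it.\<close>

definition orthonormal :: "'a set \<Rightarrow> bool" where
  "orthonormal E \<longleftrightarrow> (\<forall>x\<in>E. \<forall>y\<in>E. ip x y = (if x = y then 1 else 0))"

lemma orthonormalD: "orthonormal E \<Longrightarrow> x \<in> E \<Longrightarrow> y \<in> E \<Longrightarrow> ip x y = (if x = y then 1 else 0)"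
  by (auto simp: orthonormal_def)

lemma orthonormal_norm:
  assumes "orthonormal E" "x \<in> E"
  shows "norm x = 1"
proof -
  from assms have "(of_real ((norm x)\<^sup>2) :: 'k) = of_real 1"
    using orthonormalD[of E x x] by (simp only: ip_self[symmetric]) simp
  then have "(norm x)\<^sup>2 = 1"
    by (simp only: of_real_eq_iff)
  then show ?thesis
    by (simp add: power2_eq_1_iff) (smt (verit) norm_ge_zero)
qed

lemma ip_orthonormal_sum:
  assumes "orthonormal E" "finite F" "F \<subseteq> E" "e \<in> E"
  shows "ip (\<Sum>x\<in>F. smul (c x) x) e = (if e \<in> F then c e else 0)"
proof -
  have "ip (\<Sum>x\<in>F. smul (c x) x) e = (\<Sum>x\<in>F. if x = e then c x else 0)"
    unfolding ip_sum_left ip_smul_left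
    by (rule sum.cong) (use assms in \<open>auto simp: orthonormalD[OF assms(1)]\<close>)
  then show ?thesis
    using \<open>finite F\<close> by simp
qed

lemma norm_orthonormal_sum:
  assumes "orthonormal E" "finite F" "F \<subseteq> E"
  shows "(norm (\<Sum>x\<in>F. smul (c x) x))\<^sup>2 = (\<Sum>x\<in>F. (norm (c x))\<^sup>2)"
  using assms(2,3)
proof (induction F)
  case (insert e F)
  have "ip (\<Sum>x\<in>F. smul (c x) x) (smul (c e) e) = 0"
    using insert by (simp add: ip_smul_right ip_orthonormal_sum[OF assms(1)])
  from pythagoras[OF this] insert show ?case
    using orthonormal_norm[OF assms(1), of e] by (simp add: norm_smul add.commute)
qed simp

text \<open>The left side is the squared norm of \<open>p\<close>, the projection of
  \<open>x\<close> onto the span of \<open>F\<close>. As \<open>p\<close> is orthogonal to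
  \<open>x - p\<close>, Pythagoras applies.\<close>

lemma bessel_finite:
  assumes "orthonormal E" "finite F" "F \<subseteq> E"
  shows "(\<Sum>e\<in>F. (norm (ip x e))\<^sup>2) \<le> (norm x)\<^sup>2"
proof -
  define p where "p = (\<Sum>e\<in>F. smul (ip x e) e)"
  have "ip p (x - p) = 0"
    unfolding p_def ip_sum_left ip_smul_left
  proof (rule sum.neutral, rule ballI)
    fix e assume "e \<in> F"
    with assms have "ip (x - p) e = 0"
      by (auto simp: p_def ip_diff_left ip_orthonormal_sum[OF assms])
    then show "ip x e * ip e (x - (\<Sum>e\<in>F. smul (ip x e) e)) = 0"
      unfolding p_def by (simp add: ip_eq_zero_commute)
  qed
  from pythagoras[OF this] have "(norm p)\<^sup>2 \<le> (norm x)\<^sup>2"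
    by simp
  then show ?thesis
    by (simp add: p_def norm_orthonormal_sum[OF assms])
qed

lemma bessel_summable:
  assumes "orthonormal E"
  shows "(\<lambda>e. (norm (ip x e))\<^sup>2) summable_on E"
  by (rule nonneg_bdd_above_summable_on)
    (use bessel_finite[OF assms] in \<open>auto intro!: bdd_aboveI2\<close>)

text \<open>The squared distance between nested partial sums equals the difference of the scalar
  partial sums, so the vector sums form a Cauchy net and completeness yields a limit.\<close>

lemma riesz_fischer:
  assumes E: "orthonormal E" and c: "(\<lambda>e. (norm (c e))\<^sup>2) summable_on E"
  shows "(\<lambda>e. smul (c e) e) summable_on E"
proof -
  let ?s = "\<lambda>F. \<Sum>e\<in>F. smul (c e) e"
  let ?n = "\<lambda>F. \<Sum>e\<in>F. (norm (c e))\<^sup>2"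
  have "\<exists>P. eventually P (finite_subsets_at_top E) \<and>
          (\<forall>F F'. P F \<and> P F' \<longrightarrow> dist (?s F) (?s F') < \<epsilon>)" if "\<epsilon> > 0" for \<epsilon> :: real
  proof -
    \<comment> \<open>Beyond \<open>F0\<close> the scalar sum has at most
      \<open>(\<epsilon> / 3)\<^sup>2\<close> left. Every larger partial sum is then within
      \<open>\<epsilon> / 3\<close> of the one over \<open>F0\<close>, and any two of them are
      within \<open>2 * \<epsilon> / 3\<close> of each other.\<close>
    obtain F0 where F0: "finite F0" "F0 \<subseteq> E"
      "dist (?n F0) (\<Sum>\<^sub>\<infinity>e\<in>E. (norm (c e))\<^sup>2) \<le> (\<epsilon> / 3)\<^sup>2"
      using infsum_finite_approximation[OF c, of "(\<epsilon> / 3)\<^sup>2"] \<open>\<epsilon> > 0\<close> by auto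
    define P where "P F \<longleftrightarrow> finite F \<and> F0 \<subseteq> F \<and> F \<subseteq> E" for F
    have near: "dist (?s F) (?s F0) \<le> \<epsilon> / 3" if "P F" for F
    proof -
      have F: "finite F" "F0 \<subseteq> F" "F \<subseteq> E"
        using that by (auto simp: P_def)
      have "(dist (?s F) (?s F0))\<^sup>2 = (norm (?s (F - F0)))\<^sup>2"
        unfolding dist_norm using F by (subst sum_diff) auto
      also have "\<dots> = ?n (F - F0)"
        by (rule norm_orthonormal_sum[OF E]) (use F in auto)
      also have "\<dots> = ?n F - ?n F0"
        using F by (subst sum_diff) auto
      also have "\<dots> \<le> (\<Sum>\<^sub>\<infinity>e\<in>E. (norm (c e))\<^sup>2) - ?n F0"
        using finite_sum_le_infsum[OF c, of F] F by auto
      also have "\<dots> \<le> (\<epsilon> / 3)\<^sup>2"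
        using F0(3) by (simp add: dist_real_def)
      finally show ?thesis
        by (rule power2_le_imp_le) (use \<open>\<epsilon> > 0\<close> in simp)
    qed
    have "eventually P (finite_subsets_at_top E)"
      unfolding eventually_finite_subsets_at_top P_def using F0 by blast
    moreover have "dist (?s F) (?s F') < \<epsilon>" if "P F" "P F'" for F F'
      using near[OF that(1)] near[OF that(2)] dist_triangle2[of "?s F" "?s F'" "?s F0"] \<open>\<epsilon> > 0\<close>
      by linarith
    ultimately show ?thesis by blast
  qed
  then have "cauchy_filter (filtermap ?s (finite_subsets_at_top E))"
    by (simp add: cauchy_filter_metric_filtermap)
  moreover have "complete (UNIV :: 'a set)"
    by (meson Cauchy_convergent UNIV_I complete_def convergent_def)
  ultimately obtain y where "(?s \<longlongrightarrow> y) (finite_subsets_at_top E)"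
    using complete_uniform[where S = UNIV] by (force simp add: filterlim_def)
  then show ?thesis
    by (auto simp: summable_on_def has_sum_def)
qed

text \<open>The inner product with \<open>e\<close> passes inside the sum, where only the term at
  \<open>e\<close> survives.\<close>

lemma ip_orthonormal_series:
  assumes "orthonormal E" "((\<lambda>x. smul (c x) x) has_sum y) E" "e \<in> E"
  shows "ip y e = c e"
proof -
  have "((\<lambda>x. ip (smul (c x) x) e) has_sum ip y e) E"
    by (rule has_sum_bounded_linear[OF bounded_linear_ip_left assms(2)])
  moreover have "((\<lambda>x. ip (smul (c x) x) e) has_sum c e) E"
    by (rule has_sum_finite_neutralI[where B = "{e}"])
      (use assms orthonormalD[OF assms(1)] in \<open>auto simp: ip_smul_left\<close>)
  ultimately show ?thesis
    by (rule has_sum_unique)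
qed

lemma series_in_closure_span:
  assumes "((\<lambda>x. smul (c x) x) has_sum y) E"
  shows "y \<in> closure (span E)"
proof (rule Lim_in_closed_set)
  show "((\<lambda>F. \<Sum>x\<in>F. smul (c x) x) \<longlongrightarrow> y) (finite_subsets_at_top E)"
    using assms by (simp add: has_sum_def)
  show "\<forall>\<^sub>F F in finite_subsets_at_top E. (\<Sum>x\<in>F. smul (c x) x) \<in> closure (span E)"
    by (intro eventually_finite_subsets_at_top_weakI subsetD[OF closure_subset]
        span_sum span_scale span_base) auto
qed auto

section \<open>Orthonormal bases: existence, expansion, Parseval\<close>

text \<open>A maximal orthonormal set is a basis: if some \<open>x\<close> differed from the sum of
  its Fourier series, the normalised difference could be adjoined.\<close>

lemma orthonormal_basis_exists: "\<exists>E. orthonormal_basis smul ip E"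
proof -
  have "\<exists>E\<in>{E. orthonormal E}. \<forall>X\<in>{E. orthonormal E}. E \<subseteq> X \<longrightarrow> X = E"
  proof (rule subset_Zorn')
    fix C assume C: "subset.chain {E. orthonormal E} C"
    \<comment> \<open>Two vectors from members of the chain both lie in the larger member.\<close>
    have "ip x y = (if x = y then 1 else 0)" if "x \<in> X" "X \<in> C" "y \<in> Y" "Y \<in> C" for x y X Y
    proof -
      from C that consider "X \<subseteq> Y" | "Y \<subseteq> X"
        by (auto simp: subset.chain_def)
      then show ?thesis
        using C that by cases (auto simp: subset.chain_def orthonormal_def subset_iff)
    qed
    then show "\<Union>C \<in> {E. orthonormal E}"
      by (auto simp: orthonormal_def)
  qed
  then obtain E where E: "orthonormal E" and max: "\<And>X. orthonormal X \<Longrightarrow> E \<subseteq> X \<Longrightarrow> X = E"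
    by auto
  have "x \<in> closure (span E)" for x
  proof -
    obtain y where y: "((\<lambda>e. smul (ip x e) e) has_sum y) E"
      using riesz_fischer[OF E bessel_summable[OF E]] by (auto simp: summable_on_def)
    define z where "z = x - y"
    have orth: "ip z e = 0" if "e \<in> E" for e
      using ip_orthonormal_series[OF E y that] by (simp add: z_def ip_diff_left)
    have "z = 0"
    proof (rule ccontr)
      assume "z \<noteq> 0"
      define u where "u = smul (of_real (inverse (norm z))) z"
      have "norm u = 1"
        using \<open>z \<noteq> 0\<close> by (simp add: u_def norm_smul norm_inverse)
      then have u: "ip u u = 1" "\<And>e. e \<in> E \<Longrightarrow> ip u e = 0"
        using orth by (simp_all add: ip_self u_def ip_smul_left)
      then have "\<And>e. e \<in> E \<Longrightarrow> ip e u = 0"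
        by (simp add: ip_eq_zero_commute)
      with u E have "orthonormal (insert u E)"
        by (auto simp: orthonormal_def)
      then have "u \<in> E"
        using max by blast
      \<comment> \<open>Membership of \<open>u\<close> in \<open>E\<close> would make
        \<open>u\<close> orthogonal to itself, although \<open>ip u u = 1\<close>.\<close>
      with u show False by force
    qed
    then show ?thesis
      using series_in_closure_span[OF y] by (simp add: z_def)
  qed
  with E show ?thesis
    unfolding orthonormal_basis_def orthonormal_def by blast
qed

lemma orthonormal_basis_imp_orthonormal: "orthonormal_basis smul ip E \<Longrightarrow> orthonormal E"
  by (simp add: orthonormal_basis_def orthonormal_def)

text \<open>The series converges to some \<open>y\<close>. The error \<open>z = x - y\<close> is
  orthogonal to \<open>E\<close>, hence to the span and by continuity to its closure, which is the
  whole space and contains \<open>z\<close>.\<close>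

lemma orthonormal_basis_expansion:
  assumes "orthonormal_basis smul ip E"
  shows "((\<lambda>e. smul (ip x e) e) has_sum x) E"
proof -
  note E = orthonormal_basis_imp_orthonormal[OF assms]
  obtain y where y: "((\<lambda>e. smul (ip x e) e) has_sum y) E"
    using riesz_fischer[OF E bessel_summable[OF E]] by (auto simp: summable_on_def)
  define z where "z = x - y"
  have orth: "ip e z = 0" if "e \<in> E" for e
    using ip_orthonormal_series[OF E y that]
    by (subst ip_eq_zero_commute) (simp add: z_def ip_diff_left)
  have "ip v z = 0" if "v \<in> span E" for v
    using that
    by (induction rule: span_induct_alt)
      (simp_all add: ip_add_left ip_smul_left orth)
  moreover have "closed {v. ip v z = 0}"
    by (intro closed_Collect_eq linear_continuous_on bounded_linear_ip_left continuous_on_const)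
  ultimately have "closure (span E) \<subseteq> {v. ip v z = 0}"
    by (intro closure_minimal) auto
  then have "ip z z = 0"
    using assms by (auto simp: orthonormal_basis_def)
  then have "z = 0"
    by (simp add: ip_self)
  with y show ?thesis by (simp add: z_def)
qed

text \<open>Pass to the limit in the finite identity \<open>norm_orthonormal_sum\<close>, by
  continuity of the norm.\<close>

lemma parseval:
  assumes "orthonormal_basis smul ip E"
  shows "((\<lambda>e. (norm (ip x e))\<^sup>2) has_sum (norm x)\<^sup>2) E"
proof -
  note E = orthonormal_basis_imp_orthonormal[OF assms]
  have "((\<lambda>F. (norm (\<Sum>e\<in>F. smul (ip x e) e))\<^sup>2) \<longlongrightarrow> (norm x)\<^sup>2) (finite_subsets_at_top E)"
    using orthonormal_basis_expansion[OF assms] unfolding has_sum_def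
    by (intro tendsto_power tendsto_norm)
  moreover have "\<forall>\<^sub>F F in finite_subsets_at_top E.
      (norm (\<Sum>e\<in>F. smul (ip x e) e))\<^sup>2 = (\<Sum>e\<in>F. (norm (ip x e))\<^sup>2)"
    by (rule eventually_finite_subsets_at_top_weakI) (rule norm_orthonormal_sum[OF E])
  ultimately show ?thesis
    unfolding has_sum_def by (rule Lim_transform_eventually)
qed

section \<open>Riesz representation and the adjoint\<close>

lemma riesz_representation:
  assumes add: "\<And>x y. \<phi> (x + y) = \<phi> x + \<phi> y"
    and smul: "\<And>c x. \<phi> (smul c x) = c * \<phi> x"
    and bound: "\<And>x. norm (\<phi> x) \<le> C * norm x"
  obtains y where "\<And>x. \<phi> x = ip x y"
proof -
  obtain E where basis: "orthonormal_basis smul ip E"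
    using orthonormal_basis_exists by blast
  note E = orthonormal_basis_imp_orthonormal[OF basis]
  have "bounded_linear \<phi>"
  proof (rule bounded_linear_intro[where K = C])
    show "\<phi> (r *\<^sub>R x) = r *\<^sub>R \<phi> x" for r x
      unfolding smul_of_real[symmetric] smul by (simp add: scaleR_conv_of_real)
  qed (use add bound in \<open>auto simp: mult.commute\<close>)
  then interpret \<phi>: bounded_linear \<phi> .
  have "(\<Sum>e\<in>F. (norm (sconj (\<phi> e)))\<^sup>2) \<le> C\<^sup>2" if F: "finite F" "F \<subseteq> E" for F
  proof -
    \<comment> \<open>Evaluating \<open>\<phi>\<close> at this vector gives exactly the squared norm
      of \<open>p\<close>; the bound on \<open>\<phi>\<close> then forces \<open>norm p\<close> to
      be at most \<open>C\<close> unless \<open>p\<close> vanishes. Conjugates appear because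
      \<open>ip\<close> is conjugate-linear in its second argument.\<close>
    define p where "p = (\<Sum>e\<in>F. smul (sconj (\<phi> e)) e)"
    have p: "(\<Sum>e\<in>F. (norm (sconj (\<phi> e)))\<^sup>2) = (norm p)\<^sup>2"
      unfolding p_def by (rule norm_orthonormal_sum[OF E F, symmetric])
    have "\<phi> p = of_real (\<Sum>e\<in>F. (norm (sconj (\<phi> e)))\<^sup>2)"
      unfolding p_def \<phi>.sum smul of_real_sum
      by (simp add: mult.commute[of "sconj _"] mult_sconj_of_real)
    then have "norm (\<phi> p) = (norm p)\<^sup>2"
      unfolding p by (simp add: norm_power)
    with bound[of p] have "norm p * norm p \<le> C * norm p"
      by (simp add: power2_eq_square)
    then have "norm p \<le> C \<or> norm p = 0"
      by auto
    then have "(norm p)\<^sup>2 \<le> C\<^sup>2"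
      by (auto intro: power_mono)
    then show ?thesis by (simp only: p)
  qed
  then have "(\<lambda>e. (norm (sconj (\<phi> e)))\<^sup>2) summable_on E"
    by (intro nonneg_bdd_above_summable_on bdd_aboveI2[where M = "C\<^sup>2"]) auto
  from riesz_fischer[OF E this] obtain y where y: "((\<lambda>e. smul (sconj (\<phi> e)) e) has_sum y) E"
    by (auto simp: summable_on_def)
  have ip_y: "ip e y = \<phi> e" if "e \<in> E" for e
    using ip_orthonormal_series[OF E y that] by (metis ip_commute sconj_sconj)
  \<comment> \<open>Both sides are bounded linear in \<open>x\<close> and agree on \<open>E\<close>,
    so they agree on the expansion of \<open>x\<close>.\<close>
  have "\<phi> x = ip x y" for x
  proof -
    note x = orthonormal_basis_expansion[OF basis, of x]
    have "((\<lambda>e. \<phi> (smul (ip x e) e)) has_sum \<phi> x) E"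
      by (rule has_sum_bounded_linear[OF \<open>bounded_linear \<phi>\<close> x])
    moreover have "((\<lambda>e. ip (smul (ip x e) e) y) has_sum ip x y) E"
      by (rule has_sum_bounded_linear[OF bounded_linear_ip_left x])
    then have "((\<lambda>e. \<phi> (smul (ip x e) e)) has_sum ip x y) E"
      by (rule has_sum_cong[THEN iffD1, rotated]) (simp add: smul ip_smul_left ip_y)
    ultimately show ?thesis
      by (rule has_sum_unique)
  qed
  then show thesis by (rule that)
qed

text \<open>For fixed \<open>y\<close> the functional taking \<open>x\<close> to
  \<open>ip (T x) y\<close> is bounded by Cauchy-Schwarz; \<open>G\<close> chooses a representing
  vector for each \<open>y\<close>. Later double sums work from this identity alone.\<close>

lemma adjoint_exists:
  assumes "bounded_operator smul T"
  obtains G where "\<And>x y. ip (T x) y = ip x (G y)"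
proof -
  from assms interpret T: Vector_Spaces.linear smul smul T
    by (simp add: bounded_operator_def)
  obtain C where C: "\<And>x. norm (T x) \<le> C * norm x"
    using assms by (auto simp: bounded_operator_def)
  have "\<exists>z. \<forall>x. ip (T x) y = ip x z" for y
  proof (rule riesz_representation[where \<phi> = "\<lambda>x. ip (T x) y" and C = "C * norm y"])
    show "norm (ip (T x) y) \<le> C * norm y * norm x" for x
      using cauchy_schwarz[of "T x" y] mult_right_mono[OF C[of x], of "norm y"]
      by (simp add: mult_ac)
  qed (auto simp: T.add T.scale ip_add_left ip_smul_left)
  then show thesis
    using that by metis
qed

section \<open>Frame sums and the Hilbert-Schmidt norm through the adjoint\<close>

text \<open>Both sides are iterated sums of the squares of \<open>norm (ip (T (f k)) e)\<close>:
  Parseval evaluates the sum over \<open>e\<close>, the adjoint identity rewrites the sum over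
  \<open>k\<close>. An equivalence with a common \<open>S\<close> transfers summability and value
  together.\<close>

lemma has_sum_norm_image_iff:
  assumes adj: "\<And>x y. ip (T x) y = ip x (G y)"
    and E: "orthonormal_basis smul ip E"
    and f: "\<And>x. (\<lambda>k. (norm (ip x (f k)))\<^sup>2) summable_on K"
  shows "((\<lambda>k. (norm (T (f k)))\<^sup>2) has_sum S) K \<longleftrightarrow>
    ((\<lambda>e. \<Sum>\<^sub>\<infinity>k\<in>K. (norm (ip (G e) (f k)))\<^sup>2) has_sum S) E"
proof -
  have rows: "((\<lambda>e. (norm (ip (T (f k)) e))\<^sup>2) has_sum (norm (T (f k)))\<^sup>2) E" for k
    by (rule parseval[OF E])
  have "norm (ip (G e) (f k)) = norm (ip (T (f k)) e)" for e k
    by (simp add: adj norm_ip_commute)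
  then have cols: "((\<lambda>k. (norm (ip (T (f k)) e))\<^sup>2) has_sum
      (\<Sum>\<^sub>\<infinity>k\<in>K. (norm (ip (G e) (f k)))\<^sup>2)) K" for e
    using has_sum_infsum[OF f[of "G e"]] by simp
  show ?thesis
    using has_sum_nonneg_swap[OF _ rows cols] has_sum_nonneg_swap[OF _ cols rows] by auto
qed

text \<open>The family is now a basis indexed by itself, and Parseval collapses the inner sum. Since
  \<open>E\<close> and \<open>E'\<close> vary independently, this contains the independence of the
  choice of basis.\<close>

lemma has_sum_norm_adjoint_iff:
  assumes adj: "\<And>x y. ip (T x) y = ip x (G y)"
    and E: "orthonormal_basis smul ip E" and E': "orthonormal_basis smul ip E'"
  shows "((\<lambda>e. (norm (T e))\<^sup>2) has_sum S) E \<longleftrightarrow> ((\<lambda>e. (norm (G e))\<^sup>2) has_sum S) E'"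
  using has_sum_norm_image_iff[OF adj E', of "\<lambda>e. e" E] parseval[OF E, THEN infsumI]
    parseval[OF E, THEN has_sum_imp_summable] by simp

lemma summable_on_norm_adjoint_iff:
  assumes "\<And>x y. ip (T x) y = ip x (G y)"
    and "orthonormal_basis smul ip E" and "orthonormal_basis smul ip E'"
  shows "(\<lambda>e. (norm (T e))\<^sup>2) summable_on E \<longleftrightarrow> (\<lambda>e. (norm (G e))\<^sup>2) summable_on E'"
  unfolding summable_on_def using has_sum_norm_adjoint_iff[OF assms] by simp

text \<open>Replaces the existential basis of the definition by any prescribed one.\<close>

lemma hilbert_schmidt_iff_adjoint:
  assumes "bounded_operator smul T" "\<And>x y. ip (T x) y = ip x (G y)" "orthonormal_basis smul ip E"
  shows "hilbert_schmidt smul ip T \<longleftrightarrow> (\<lambda>e. (norm (G e))\<^sup>2) summable_on E"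
  using assms summable_on_norm_adjoint_iff[OF assms(2) _ assms(3)]
  unfolding hilbert_schmidt_def by blast

lemma hs_norm_eq_adjoint:
  assumes "hilbert_schmidt smul ip T" "\<And>x y. ip (T x) y = ip x (G y)" "orthonormal_basis smul ip E"
  shows "hs_norm smul ip T = sqrt (\<Sum>\<^sub>\<infinity>e\<in>E. (norm (G e))\<^sup>2)"
proof -
  let ?E = "SOME E. orthonormal_basis smul ip E"
  \<comment> \<open>Existence of a basis makes the choice in \<open>hs_norm\<close> a genuine
    basis.\<close>
  have E: "orthonormal_basis smul ip ?E"
    using orthonormal_basis_exists by (rule someI_ex)
  have "(\<lambda>e. (norm (G e))\<^sup>2) summable_on E"
    using assms hilbert_schmidt_iff_adjoint[of T G E] by (auto simp: hilbert_schmidt_def)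
  then have "((\<lambda>e. (norm (T e))\<^sup>2) has_sum (\<Sum>\<^sub>\<infinity>e\<in>E. (norm (G e))\<^sup>2)) ?E"
    unfolding has_sum_norm_adjoint_iff[OF assms(2) E assms(3)] by (rule has_sum_infsum)
  then show ?thesis
    unfolding hs_norm_def by (simp add: infsumI)
qed

text \<open>At each \<open>G e\<close> the frame sum lies between \<open>A\<close> and
  \<open>B\<close> times the squared norm of \<open>G e\<close>, so comparison works in both
  directions. As the frame is arbitrary, this single equivalence serves both the existential and the
  universal criterion.\<close>

lemma frame_summable_iff:
  assumes T: "bounded_operator smul T" and f: "frame_with_bounds ip K f A B"
  shows "(\<lambda>k. (norm (T (f k)))\<^sup>2) summable_on K \<longleftrightarrow> hilbert_schmidt smul ip T"
proof -
  obtain G where adj: "\<And>x y. ip (T x) y = ip x (G y)"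
    using adjoint_exists[OF T] by blast
  obtain E where E: "orthonormal_basis smul ip E"
    using orthonormal_basis_exists by blast
  let ?q = "\<lambda>e. \<Sum>\<^sub>\<infinity>k\<in>K. (norm (ip (G e) (f k)))\<^sup>2"
  have "A > 0" and fK: "\<And>x. (\<lambda>k. (norm (ip x (f k)))\<^sup>2) summable_on K"
    and lower: "\<And>e. A * (norm (G e))\<^sup>2 \<le> ?q e" and upper: "\<And>e. ?q e \<le> B * (norm (G e))\<^sup>2"
    using f by (auto simp: frame_with_bounds_def)
  have "(\<lambda>k. (norm (T (f k)))\<^sup>2) summable_on K \<longleftrightarrow> ?q summable_on E"
    unfolding summable_on_def using has_sum_norm_image_iff[OF adj E fK] by simp
  also have "\<dots> \<longleftrightarrow> (\<lambda>e. (norm (G e))\<^sup>2) summable_on E"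
  proof
    assume "?q summable_on E"
    then have "(\<lambda>e. A * (norm (G e))\<^sup>2) summable_on E"
      by (rule summable_on_comparison_test) (use lower \<open>A > 0\<close> in auto)
    then show "(\<lambda>e. (norm (G e))\<^sup>2) summable_on E"
      using \<open>A > 0\<close> by (simp add: summable_on_cmult_right')
  next
    assume "(\<lambda>e. (norm (G e))\<^sup>2) summable_on E"
    then have "(\<lambda>e. B * (norm (G e))\<^sup>2) summable_on E"
      by (rule summable_on_cmult_right)
    then show "?q summable_on E"
      by (rule summable_on_comparison_test) (use upper in \<open>auto intro: infsum_nonneg\<close>)
  qed
  also have "\<dots> \<longleftrightarrow> hilbert_schmidt smul ip T"
    using hilbert_schmidt_iff_adjoint[OF T adj E] by simp
  finally show ?thesis .
qed

text \<open>The frame inequalities at the vectors \<open>G e\<close> are summed over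
  \<open>e\<close>; the sum \<open>?N\<close> is the square of the Hilbert-Schmidt norm, and square
  roots finish.\<close>

lemma frame_hs_norm_bounds:
  assumes T: "hilbert_schmidt smul ip T" and f: "frame_with_bounds ip K f A B"
  shows "sqrt A * hs_norm smul ip T \<le> sqrt (\<Sum>\<^sub>\<infinity>k\<in>K. (norm (T (f k)))\<^sup>2)"
    and "sqrt (\<Sum>\<^sub>\<infinity>k\<in>K. (norm (T (f k)))\<^sup>2) \<le> sqrt B * hs_norm smul ip T"
proof -
  have bop: "bounded_operator smul T"
    using T by (simp add: hilbert_schmidt_def)
  obtain G where adj: "\<And>x y. ip (T x) y = ip x (G y)"
    using adjoint_exists[OF bop] by blast
  obtain E where E: "orthonormal_basis smul ip E"
    using orthonormal_basis_exists by blast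
  let ?q = "\<lambda>e. \<Sum>\<^sub>\<infinity>k\<in>K. (norm (ip (G e) (f k)))\<^sup>2"
  let ?S = "\<Sum>\<^sub>\<infinity>k\<in>K. (norm (T (f k)))\<^sup>2"
  let ?N = "\<Sum>\<^sub>\<infinity>e\<in>E. (norm (G e))\<^sup>2"
  have fK: "\<And>x. (\<lambda>k. (norm (ip x (f k)))\<^sup>2) summable_on K"
    and lower: "\<And>e. A * (norm (G e))\<^sup>2 \<le> ?q e" and upper: "\<And>e. ?q e \<le> B * (norm (G e))\<^sup>2"
    using f by (auto simp: frame_with_bounds_def)
  \<comment> \<open>Summability ensures that \<open>?S\<close> is a true sum and not the default
    value 0 of \<open>infsum\<close>.\<close>
  have "((\<lambda>k. (norm (T (f k)))\<^sup>2) has_sum ?S) K"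
    by (rule has_sum_infsum) (simp add: frame_summable_iff[OF bop f] T)
  then have q: "(?q has_sum ?S) E"
    unfolding has_sum_norm_image_iff[OF adj E fK] .
  have G: "((\<lambda>e. (norm (G e))\<^sup>2) has_sum ?N) E"
    using T hilbert_schmidt_iff_adjoint[OF bop adj E] by (simp add: has_sum_infsum)
  have "A * ?N \<le> ?S"
    by (rule has_sum_mono[OF has_sum_cmult_right[OF G] q]) (rule lower)
  moreover have "?S \<le> B * ?N"
    by (rule has_sum_mono[OF q has_sum_cmult_right[OF G]]) (rule upper)
  ultimately show "sqrt A * hs_norm smul ip T \<le> sqrt ?S" "sqrt ?S \<le> sqrt B * hs_norm smul ip T"
    unfolding hs_norm_eq_adjoint[OF T adj E] real_sqrt_mult[symmetric] by simp_all
qed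

section \<open>Separability and existence of a frame\<close>

text \<open>Distinct orthonormal vectors are at distance \<open>sqrt 2\<close>, so points of a
  countable dense set chosen within \<open>1 / 2\<close> of them are distinct.\<close>

lemma orthonormal_countable:
  assumes "separable_space (euclidean :: 'a topology)" and E: "orthonormal E"
  shows "countable E"
proof -
  obtain D :: "'a set" where D: "countable D" "closure D = UNIV"
    using assms(1) by (auto simp: separable_space_def)
  have "\<exists>d\<in>D. dist d e < 1 / 2" for e
    using D(2) closure_approachable[of e D] half_gt_zero[OF zero_less_one] by blast
  then obtain d where d: "\<And>e. d e \<in> D" "\<And>e. dist (d e) e < 1 / 2"
    by metis
  have "inj_on d E"
  proof (rule inj_onI, rule ccontr)
    fix x y assume xy: "x \<in> E" "y \<in> E" "d x = d y" "x \<noteq> y"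
    have "ip x (- y) = 0"
      using orthonormalD[OF E] xy ip_smul_right[of x "of_real (- 1)" y] by (simp add: smul_of_real)
    from pythagoras[OF this] have "(norm (x - y))\<^sup>2 = 2"
      using orthonormal_norm[OF E] xy by simp
    moreover have "norm (x - y) < 1"
      using d(2)[of x] d(2)[of y] xy dist_triangle3[of x y "d x"] by (simp add: dist_norm)
    ultimately show False
      using power_mono[of "norm (x - y)" 1 2] by simp
  qed
  moreover have "countable (d ` E)"
    using d(1) by (intro countable_subset[OF _ D(1)]) auto
  ultimately show ?thesis
    by (simp add: countable_image_inj_eq)
qed

text \<open>By Parseval an orthonormal basis is a frame with both bounds 1. Countability lets its
  members be indexed injectively through \<open>nat\<close> inside the infinite type
  \<open>'i\<close>.\<close>

lemma frame_exists:
  assumes "separable_space (euclidean :: 'a topology)"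
  shows "\<exists>(K :: 'i::infinite set) f. is_frame ip K f"
proof -
  obtain E where E: "orthonormal_basis smul ip E"
    using orthonormal_basis_exists by blast
  then have E_countable: "countable E"
    using assms orthonormal_basis_imp_orthonormal orthonormal_countable by blast
  obtain h :: "nat \<Rightarrow> 'i" where "inj h"
    using infinite_countable_subset[OF infinite_UNIV] by blast
  then have g: "inj_on (h \<circ> to_nat_on E) E" (is "inj_on ?g E")
    using inj_on_to_nat_on[OF E_countable] by (auto simp: inj_on_def)
  \<comment> \<open>The index of a basis vector \<open>e\<close> is \<open>?g e\<close>, so the
    frame sends an index back to its vector.\<close>
  let ?f = "inv_into E ?g"
  have "((\<lambda>k. (norm (ip x (?f k)))\<^sup>2) has_sum (norm x)\<^sup>2) (?g ` E)" for x
    unfolding has_sum_reindex[OF g] using parseval[OF E, of x]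
    by (rule has_sum_cong[THEN iffD1, rotated])
      (simp only: o_def[of "\<lambda>k. (norm (ip x (?f k)))\<^sup>2"] inv_into_f_f[OF g])
  from this[THEN infsumI] this[THEN has_sum_imp_summable]
  have "frame_with_bounds ip (?g ` E) ?f 1 1"
    using E_countable by (simp add: frame_with_bounds_def del: o_apply)
  then show ?thesis
    unfolding is_frame_def by blast
qed

end

section \<open>The equivalences and the norm estimates\<close>

theorem proposition3p3:
  fixes smul :: "'k::real_or_complex \<Rightarrow> 'a::banach \<Rightarrow> 'a"
    and ip :: "'a \<Rightarrow> 'a \<Rightarrow> 'k"
    and H :: "'a \<Rightarrow> 'a"
  assumes "hilbert_space smul ip"
    and "infinite_dimensional smul"
    and "separable_space (euclidean :: 'a topology)"
    and "bounded_operator smul H"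
  shows
    "(hilbert_schmidt smul ip H \<longleftrightarrow>
        (\<exists>(K :: 'i::infinite set) f. is_frame ip K f \<and> (\<lambda>k. (norm (H (f k)))\<^sup>2) summable_on K)) \<and>
     (hilbert_schmidt smul ip H \<longleftrightarrow>
        (\<forall>(K :: 'i set) f. is_frame ip K f \<longrightarrow> (\<lambda>k. (norm (H (f k)))\<^sup>2) summable_on K)) \<and>
     (hilbert_schmidt smul ip H \<longrightarrow>
        (\<forall>(K :: 'j set) f A B. frame_with_bounds ip K f A B \<longrightarrow>
           (\<lambda>k. (norm (H (f k)))\<^sup>2) summable_on K \<and>
           sqrt A * hs_norm smul ip H \<le> sqrt (\<Sum>\<^sub>\<infinity>k\<in>K. (norm (H (f k)))\<^sup>2) \<and>
           sqrt (\<Sum>\<^sub>\<infinity>k\<in>K. (norm (H (f k)))\<^sup>2) \<le> sqrt B * hs_norm smul ip H)) \<and>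
     (hilbert_schmidt smul ip H \<longrightarrow>
        (\<forall>(K :: 'j set) f A. frame_with_bounds ip K f A A \<longrightarrow>
           hs_norm smul ip H = 1 / sqrt A * sqrt (\<Sum>\<^sub>\<infinity>k\<in>K. (norm (H (f k)))\<^sup>2)))"
proof -
  interpret hilbert_space smul ip by fact
  note summable_iff = frame_summable_iff[OF \<open>bounded_operator smul H\<close>]
  show ?thesis
  proof (intro conjI impI allI)
    show "hilbert_schmidt smul ip H \<longleftrightarrow>
        (\<exists>(K :: 'i set) f. is_frame ip K f \<and> (\<lambda>k. (norm (H (f k)))\<^sup>2) summable_on K)"
      using frame_exists[OF assms(3)] summable_iff unfolding is_frame_def by blast
    show "hilbert_schmidt smul ip H \<longleftrightarrow>
        (\<forall>(K :: 'i set) f. is_frame ip K f \<longrightarrow> (\<lambda>k. (norm (H (f k)))\<^sup>2) summable_on K)"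
      \<comment> \<open>An existing frame keeps the universal condition from being vacuous:
        instantiating it there gives the Hilbert-Schmidt property.\<close>
      using frame_exists[OF assms(3)] summable_iff unfolding is_frame_def by blast
  next
    fix K :: "'j set" and f A B
    assume HS: "hilbert_schmidt smul ip H" and f: "frame_with_bounds ip K f A B"
    show "(\<lambda>k. (norm (H (f k)))\<^sup>2) summable_on K"
      using HS summable_iff[OF f] by simp
    show "sqrt A * hs_norm smul ip H \<le> sqrt (\<Sum>\<^sub>\<infinity>k\<in>K. (norm (H (f k)))\<^sup>2)"
      "sqrt (\<Sum>\<^sub>\<infinity>k\<in>K. (norm (H (f k)))\<^sup>2) \<le> sqrt B * hs_norm smul ip H"
      by (rule frame_hs_norm_bounds[OF HS f])+
  next
    fix K :: "'j set" and f A
    assume HS: "hilbert_schmidt smul ip H" and f: "frame_with_bounds ip K f A A"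
    have "A > 0"
      using f by (simp add: frame_with_bounds_def)
    \<comment> \<open>For equal bounds the two estimates become an equality, which is divided by
      \<open>sqrt A\<close>.\<close>
    with frame_hs_norm_bounds[OF HS f]
    show "hs_norm smul ip H = 1 / sqrt A * sqrt (\<Sum>\<^sub>\<infinity>k\<in>K. (norm (H (f k)))\<^sup>2)"
      by (simp add: field_simps)
  qed
qed

end
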